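(* Let $n\ge 2$ be an integer. Let $\mathfrak A$ and $\mathfrak A'$ be two $C^*$-algebras with identities $I_{\mathfrak A}$ and $I_{\mathfrak A'}$, respectively, and let $P_1$ and $P_2=I_{\mathfrak A}-P_1$ be nontrivial symmetric projections in $\mathfrak A$. Suppose that for each $j\in\{1,2\}$ and each $X\in\mathfrak A$, $P_j\mathfrak A X=\{0\}$ implies $X=0$. Suppose moreover that $\varphi:\mathfrak A\to\mathfrak A'$ is a bijective unital map (not assumed additive) which satisfies $$\varphi\big(p_{n_*}(A,B,\Xi,\ldots,\Xi)\big)=p_{n_*}\big(\varphi(A),\varphi(B),\varphi(\Xi),\ldots,\varphi(\Xi)\big)$$ for all $A,B\in\mathfrak A$ and all $\Xi\in\{P_1,P_2,I_{\mathfrak A}\}$ (the same $\Xi$ in each of the last $n-2$ slots). Then $\varphi$ is $*$-additive.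
   Context: A $C^*$-algebra is a complete normed complex algebra with a conjugate-linear algebra involution $*$ satisfying $\|a^*a\|=\|a\|^2$. For elements $x,y$ of a $*$-algebra, $[x,y]_*=xy-yx^*$. The polynomials $p_{n_*}$ are defined by $p_{1_*}(x)=x$ and $p_{n_*}(x_1,\ldots,x_n)=[p_{(n-1)_*}(x_1,\ldots,x_{n-1}),x_n]_*$ for $n\ge 2$. A symmetric projection is an element $P$ with $P^2=P=P^*$; nontrivial means different from $0$ and the identity. Unital means $\varphi(I_{\mathfrak A})=I_{\mathfrak A'}$. $*$-additive means $\varphi(A+B)=\varphi(A)+\varphi(B)$ and $\varphi(A^* )=\varphi(A)^*$ for all $A,B\in\mathfrak A$. *)

theory Defs
  imports "HOL-Analysis.Analysis"
begin

text \<open>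
  The real scalar multiplication inherited from \<^class>\<open>real_normed_algebra\<close> is the
  restriction of the complex one; completeness comes from \<^class>\<open>banach\<close>.
\<close>

class cstar_algebra = real_normed_algebra + banach +
  fixes scaleC :: "complex \<Rightarrow> 'a \<Rightarrow> 'a" (infixr "*\<^sub>C" 75)
    and star :: "'a \<Rightarrow> 'a"
  assumes scaleC_add_right: "c *\<^sub>C (x + y) = c *\<^sub>C x + c *\<^sub>C y"
    and scaleC_add_left: "(c + d) *\<^sub>C x = c *\<^sub>C x + d *\<^sub>C x"
    and scaleC_scaleC: "c *\<^sub>C d *\<^sub>C x = (c * d) *\<^sub>C x"
    and scaleR_scaleC: "r *\<^sub>R x = complex_of_real r *\<^sub>C x"
    and mult_scaleC_left: "(c *\<^sub>C x) * y = c *\<^sub>C (x * y)"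
    and mult_scaleC_right: "x * (c *\<^sub>C y) = c *\<^sub>C (x * y)"
    and norm_scaleC: "norm (c *\<^sub>C x) = cmod c * norm x"
    and star_add: "star (x + y) = star x + star y"
    and star_scaleC: "star (c *\<^sub>C x) = cnj c *\<^sub>C star x"
    and star_mult: "star (x * y) = star y * star x"
    and star_star: "star (star x) = x"
    and cstar_identity: "norm (star x * x) = (norm x)\<^sup>2"

text \<open>
  The identity is added through \<^class>\<open>monoid_mult\<close> rather than \<^class>\<open>ring_1\<close>, so that
  \<open>0 \<noteq> 1\<close> is not imposed.
\<close>

class unital_cstar_algebra = cstar_algebra + monoid_mult

definition star_lie :: "'a::cstar_algebra \<Rightarrow> 'a \<Rightarrow> 'a" where
  "star_lie x y = x * y - y * star x"

text \<open>
  The polynomial \<open>p\<^bsub>n*\<^esub>(x\<^sub>1, \<dots>, x\<^sub>n)\<close> is \<open>p_star [x\<^sub>1, \<dots>, x\<^sub>n]\<close>, where \<open>n\<close> is the length of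
  the list; the value on the empty list is irrelevant. The two lemmas are the
  recursive description of these polynomials.
\<close>

definition p_star :: "'a::cstar_algebra list \<Rightarrow> 'a" where
  "p_star xs = foldl star_lie (hd xs) (tl xs)"

lemma p_star_singleton: "p_star [x] = x"
  by (simp add: p_star_def)

lemma p_star_snoc: "xs \<noteq> [] \<Longrightarrow> p_star (xs @ [x]) = star_lie (p_star xs) x"
  by (simp add: p_star_def)

definition symmetric_projection :: "'a::cstar_algebra \<Rightarrow> bool" where
  "symmetric_projection P \<longleftrightarrow> P * P = P \<and> star P = P"

definition nontrivial_symmetric_projection :: "'a::unital_cstar_algebra \<Rightarrow> bool" where
  "nontrivial_symmetric_projection P \<longleftrightarrow> symmetric_projection P \<and> P \<noteq> 0 \<and> P \<noteq> 1"

definition star_additive :: "('a::cstar_algebra \<Rightarrow> 'b::cstar_algebra) \<Rightarrow> bool" where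
  "star_additive \<phi> \<longleftrightarrow>
    (\<forall>A B. \<phi> (A + B) = \<phi> A + \<phi> B) \<and> (\<forall>A. \<phi> (star A) = star (\<phi> A))"

end

theory Submission
  imports Defs
begin

text \<open>
  Write \<open>[x, y]\<close> for \<^const>\<open>star_lie\<close>, put \<open>p = P1\<close>, \<open>q = P2\<close>, and let \<open>T\<^sub>p(X, H)\<close> be
  \<open>[X, H]\<close> bracketed \<open>k = n - 2\<close> times with \<open>p\<close>. Preservation for \<open>n = 2\<close> implies preservation
  for \<open>n = 3\<close>, so \<open>k \<ge> 1\<close> may be assumed. Bracketing with \<open>p\<close> then acts as a filter: if the
  corner \<open>p[X, H]p\<close> vanishes, then \<open>T\<^sub>p(X, H) = V - V\<^sup>*\<close> with \<open>V = q[X, H]p\<close>, whatever the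
  other corners are (\<open>p_tail_corner\<close>). Two choices of \<open>X\<close> turn this into probes that see exactly one
  Peirce corner of \<open>H\<close>:
  \<open>X = q\<close> gives \<open>V = qHp\<close>, and \<open>X = qYp\<close> gives \<open>V = qYpHp\<close>. The latter determine \<open>pHp\<close>
  as \<open>Y\<close> varies, because \<open>q\<AA>x = 0\<close> forces \<open>x = 0\<close>. Exchanging \<open>p\<close> and \<open>q\<close> gives the
  other two corners.

  Given \<open>A\<close> and \<open>B\<close>, surjectivity yields \<open>H\<close> with \<open>\<phi>(H) = \<phi>(A) + \<phi>(B)\<close>. Since the
  polynomials are additive in each of their first two arguments, in the target algebra as well,
  \<open>\<phi>(T(X, H)) = \<phi>(T(X, A)) + \<phi>(T(X, B))\<close>. If \<open>\<phi>\<close> is additive at each pair of probe values,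
  then injectivity shows that \<open>H\<close> and \<open>A + B\<close> have the same probe values, hence are equal
  (\<open>additive_atI\<close>). This criterion is used twice.
  It first applies when no corner is nonzero in both \<open>A\<close> and \<open>B\<close>, since each
  probe then kills one of them (\<open>additive_at_disjoint\<close>). That suffices to expand
  \<open>T\<^sub>q(p + a, q + b) = (a - a\<^sup>*) + (b - b\<^sup>*)\<close> for \<open>a, b \<in> p\<AA>q\<close> on both sides of \<open>\<phi>\<close>, which makes
  \<open>\<phi>\<close> additive on the elements \<open>a - a\<^sup>*\<close> (\<open>additive_at_skew_corners\<close>). But every probe value has
  this form, up to exchanging \<open>p\<close> and \<open>q\<close>, so a second application of the criterion gives
  additivity everywhere.

  Once \<open>\<phi>\<close> is additive, it preserves the involution because
  \<open>p\<^bsub>n*\<^esub>(A, 1, \<dots>, 1)\<close> is a power of two times \<open>A - A\<^sup>*\<close>.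
\<close>

section \<open>The involution and iterated products with a fixed factor\<close>

lemma star_zero [simp]: "star (0::'a::cstar_algebra) = 0"
  using star_add[of "0::'a" 0] by simp

lemma star_minus: "star (- x :: 'a::cstar_algebra) = - star x"
  using star_add[of x "- x"] by (simp add: eq_neg_iff_add_eq_0 add.commute)

lemma star_diff: "star (x - y :: 'a::cstar_algebra) = star x - star y"
  using star_add[of x "- y"] by (simp add: star_minus)

lemma scaleC_diff: "c *\<^sub>C (x - y :: 'a::cstar_algebra) = c *\<^sub>C x - c *\<^sub>C y"
  using scaleC_add_right[of c "x - y" y] by (simp add: algebra_simps)

text \<open>
  This is \<open>p\<^bsub>n*\<^esub>(A, B, \<Xi>, \<dots>, \<Xi>)\<close> for \<open>n = k + 2\<close>, written as an iteration so that
  inductions run over the number of factors \<open>\<Xi>\<close>.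
\<close>

definition p_tail :: "nat \<Rightarrow> 'a::cstar_algebra \<Rightarrow> 'a \<Rightarrow> 'a \<Rightarrow> 'a" where
  "p_tail k \<Xi> A B = ((\<lambda>C. star_lie C \<Xi>) ^^ k) (star_lie A B)"

lemma p_star_replicate: "p_star (A # B # replicate k \<Xi>) = p_tail k \<Xi> A B"
proof -
  have "foldl star_lie C (replicate k \<Xi>) = ((\<lambda>C. star_lie C \<Xi>) ^^ k) C" for C
    by (induction k arbitrary: C) (simp_all add: funpow_Suc_right del: funpow.simps)
  then show ?thesis by (simp add: p_star_def p_tail_def)
qed

lemma star_lie_add_left: "star_lie (A + B) C = star_lie A C + star_lie B C"
  by (simp add: star_lie_def star_add algebra_simps)

lemma star_lie_add_right: "star_lie A (B + C) = star_lie A B + star_lie A C"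
  by (simp add: star_lie_def algebra_simps)

lemma p_tail_add_left: "p_tail k \<Xi> (A + B) C = p_tail k \<Xi> A C + p_tail k \<Xi> B C"
  by (induction k) (simp_all add: p_tail_def star_lie_add_left)

lemma p_tail_add_right: "p_tail k \<Xi> A (B + C) = p_tail k \<Xi> A B + p_tail k \<Xi> A C"
  by (induction k) (simp_all add: p_tail_def star_lie_add_left star_lie_add_right)

lemma p_tail_zero_left [simp]: "p_tail k \<Xi> 0 B = 0"
  using p_tail_add_left[of k \<Xi> 0 0 B] by simp

lemma p_tail_zero_right [simp]: "p_tail k \<Xi> A 0 = 0"
  using p_tail_add_right[of k \<Xi> A 0 0] by simp

text \<open>
  The first bracket with \<open>1\<close> produces the skew-adjoint element \<open>A - A\<^sup>*\<close>, and a bracket of a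
  skew-adjoint element with \<open>1\<close> doubles it.
\<close>

lemma p_tail_one:
  "p_tail k 1 A 1 = 2 ^ k *\<^sub>R (A - star A)" for A :: "'a::unital_cstar_algebra"
proof (induction k)
  case 0
  show ?case by (simp add: p_tail_def star_lie_def)
next
  case (Suc k)
  have skew: "star (c *\<^sub>R (A - star A)) = - (c *\<^sub>R (A - star A))" for c :: real
    by (simp add: scaleR_scaleC star_scaleC star_diff star_star scaleC_diff)
  have "p_tail (Suc k) 1 A 1 = star_lie (p_tail k 1 A 1) 1"
    by (simp add: p_tail_def)
  also have "\<dots> = 2 ^ k *\<^sub>R (A - star A) + 2 ^ k *\<^sub>R (A - star A)"
    by (simp only: Suc star_lie_def skew mult_1_left mult_1_right diff_minus_eq_add)
  finally show ?case
    by (simp flip: scaleR_add_left)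
qed

definition skew :: "'a::cstar_algebra \<Rightarrow> 'a" where
  "skew V = V - star V"

lemma skew_zero [simp]: "skew 0 = 0"
  by (simp add: skew_def)

section \<open>Peirce corners seen by iterated products\<close>

locale projection_pair =
  fixes p q :: "'a::unital_cstar_algebra"
  assumes p_idem: "p * p = p" and q_idem: "q * q = q"
    and star_p: "star p = p" and star_q: "star q = q"
    and sum_one: "p + q = 1"
begin

lemma pq: "p * q = 0"
proof -
  have "p * (p + q) = p" by (simp add: sum_one)
  then show ?thesis by (simp add: distrib_left p_idem)
qed

lemma qp: "q * p = 0"
proof -
  have "q * (p + q) = q" by (simp add: sum_one)
  then show ?thesis by (simp add: distrib_left q_idem)
qed

lemma assoc_rules:
  "p * (p * x) = p * x" "q * (q * x) = q * x" "p * (q * x) = 0" "q * (p * x) = 0"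
  by (simp_all add: p_idem q_idem pq qp flip: mult.assoc)

lemmas peirce_simps = p_idem q_idem star_p star_q pq qp assoc_rules
  mult.assoc star_mult star_star star_add star_diff

lemma peirce_sum: "p * x * p + p * x * q + (q * x * p + q * x * q) = x"
proof -
  have "(p + q) * x * (p + q) = x" by (simp add: sum_one)
  then show ?thesis by (simp only: distrib_left distrib_right add.assoc add.left_commute)
qed

lemma peirce_eqI:
  assumes "p * x * p = p * y * p" "p * x * q = p * y * q"
    "q * x * p = q * y * p" "q * x * q = q * y * q"
  shows "x = y"
  using peirce_sum[of x] unfolding assms peirce_sum by simp

text \<open>
  One bracket with \<open>p\<close> sends \<open>C\<close> to \<open>Cp - pC\<^sup>*\<close>. When \<open>pCp = 0\<close> this is \<open>V - V\<^sup>*\<close> with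
  \<open>V = qCp\<close>, and since \<open>Vp = V\<close> and \<open>pV = 0\<close>, it is a fixed point of further brackets. At least
  one bracket is necessary, as the first one removes the corners \<open>pCq\<close> and \<open>qCq\<close>.
\<close>

lemma p_tail_corner:
  assumes "k \<ge> 1" "p * star_lie X H * p = 0"
  shows "p_tail k p X H = skew (q * star_lie X H * p)"
  using assms(1)
proof (induction k rule: dec_induct)
  case base
  define C where "C = star_lie X H"
  have C: "p * (C * p) = 0" using assms(2) by (simp add: C_def mult.assoc)
  have 1: "C * p = q * C * p"
  proof -
    have "C * p = (p + q) * (C * p)" by (simp add: sum_one)
    then show ?thesis using C by (simp add: distrib_right mult.assoc)
  qed
  from arg_cong[OF this, of star] have 2: "p * star C = star (q * C * p)"
    by (simp add: peirce_simps)
  show ?case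
    using 1 2 by (simp add: p_tail_def star_lie_def[of C p] skew_def flip: C_def)
next
  case (step k)
  have "star_lie (skew (q * C * p)) p = skew (q * C * p)" for C
    by (simp add: star_lie_def skew_def peirce_simps algebra_simps)
  with step.IH show ?case by (simp add: p_tail_def)
qed

lemma p_tail_projection:
  assumes "k \<ge> 1"
  shows "p_tail k p q H = skew (q * H * p)"
proof -
  have "p * star_lie q H * p = 0"
    by (simp add: star_lie_def peirce_simps algebra_simps)
  moreover have "q * star_lie q H * p = q * H * p"
    by (simp add: star_lie_def peirce_simps algebra_simps)
  ultimately show ?thesis using p_tail_corner[OF assms] by metis
qed

text \<open>
  The probes \<open>X = qYp\<close> read off \<open>pHp\<close>. The subtrahend \<open>HX\<^sup>*\<close> of the bracket ends in \<open>q\<close>, so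
  it contributes nothing to \<open>q[X, H]p\<close>.
\<close>

lemma p_tail_offdiag:
  assumes "k \<ge> 1"
  shows "p_tail k p (q * Y * p) H = skew (q * Y * p * H * p)"
proof -
  have "p * star_lie (q * Y * p) H * p = 0"
    by (simp add: star_lie_def peirce_simps algebra_simps)
  moreover have "q * star_lie (q * Y * p) H * p = q * Y * p * H * p"
    by (simp add: star_lie_def peirce_simps algebra_simps)
  ultimately show ?thesis using p_tail_corner[OF assms] by metis
qed

lemma skew_corner_inj:
  assumes "skew (q * V * p) = skew (q * W * p)"
  shows "q * V * p = q * W * p"
proof -
  have "q * skew (q * x * p) * p = q * x * p" for x
    by (simp add: skew_def peirce_simps algebra_simps)
  with assms show ?thesis by metis
qed

end

section \<open>Additivity of a preserver\<close>

locale peirce_preserver = projection_pair p q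
  for p q :: "'a::unital_cstar_algebra" +
  fixes \<phi> :: "'a \<Rightarrow> 'b::unital_cstar_algebra" and k :: nat
  assumes k: "k \<ge> 1"
    and bij: "bij \<phi>"
    and faithful_p: "(\<And>Y. p * Y * x = 0) \<Longrightarrow> x = 0"
    and faithful_q: "(\<And>Y. q * Y * x = 0) \<Longrightarrow> x = 0"
    and preserves_p: "\<phi> (p_tail k p A B) = p_tail k (\<phi> p) (\<phi> A) (\<phi> B)"
    and preserves_q: "\<phi> (p_tail k q A B) = p_tail k (\<phi> q) (\<phi> A) (\<phi> B)"
begin

text \<open>
  The assumptions are symmetric in \<open>p\<close> and \<open>q\<close>, so each statement about the corners \<open>qHp\<close> and
  \<open>pHp\<close> also yields the one about \<open>pHq\<close> and \<open>qHq\<close>.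
\<close>

lemma swapped: "peirce_preserver q p \<phi> k"
proof unfold_locales
  show "q + p = 1" using sum_one by (simp add: add.commute)
  show "x = 0" if "\<And>Y. q * Y * x = 0" for x using that by (rule faithful_q)
  show "x = 0" if "\<And>Y. p * Y * x = 0" for x using that by (rule faithful_p)
qed (rule p_idem q_idem star_p star_q k bij preserves_p preserves_q)+

text \<open>Any product with first factor \<open>0\<close> vanishes; \<open>B\<close> is chosen so that the image product does too.\<close>

lemma map_zero [simp]: "\<phi> 0 = 0"
proof -
  obtain B where "\<phi> B = 0" using bij by (metis bij_is_surj surjD)
  then show ?thesis using preserves_p[of 0 B] by simp
qed

definition additive_at :: "'a \<Rightarrow> 'a \<Rightarrow> bool" where
  "additive_at A B \<longleftrightarrow> \<phi> (A + B) = \<phi> A + \<phi> B"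

lemma additive_at_zero [simp]: "additive_at 0 B" "additive_at A 0"
  by (simp_all add: additive_at_def)

text \<open>
  Additivity of \<^const>\<open>p_tail\<close> in its second factor is available in the target algebra, where
  \<open>\<phi> H\<close> splits, so a probe transports the splitting of \<open>\<phi> H\<close> to its own values.
\<close>

lemma p_tail_eq:
  assumes H: "\<phi> H = \<phi> A + \<phi> B"
    and "additive_at (p_tail k p X A) (p_tail k p X B)"
  shows "p_tail k p X H = p_tail k p X (A + B)"
proof -
  have "\<phi> (p_tail k p X H) = \<phi> (p_tail k p X A) + \<phi> (p_tail k p X B)"
    by (simp add: preserves_p H p_tail_add_right)
  also have "\<dots> = \<phi> (p_tail k p X (A + B))"
    using assms(2) by (simp add: additive_at_def p_tail_add_right)
  finally show ?thesis using bij by (simp add: bij_def inj_eq)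
qed

lemma corner_qp_eq:
  assumes "\<phi> H = \<phi> A + \<phi> B"
    and "additive_at (skew (q * A * p)) (skew (q * B * p))"
  shows "q * H * p = q * (A + B) * p"
  using p_tail_eq[of H A B q] assms by (intro skew_corner_inj) (simp add: p_tail_projection[OF k])

text \<open>
  The probes only determine the products \<open>qYpHp\<close>; faithfulness of the ideal generated by \<open>q\<close>
  removes the factor \<open>qY\<close>.
\<close>

lemma corner_pp_eq:
  assumes "\<phi> H = \<phi> A + \<phi> B"
    and "\<And>Y. additive_at (skew (q * Y * p * A * p)) (skew (q * Y * p * B * p))"
  shows "p * H * p = p * (A + B) * p"
proof -
  have "q * Y * (p * H * p - p * (A + B) * p) = 0" for Y
  proof -
    have "skew (q * (Y * p * H) * p) = skew (q * (Y * p * (A + B)) * p)"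
      using p_tail_eq[of H A B "q * Y * p"] assms
      unfolding p_tail_offdiag[OF k] by (simp add: mult.assoc)
    from skew_corner_inj[OF this] show ?thesis
      by (simp add: right_diff_distrib mult.assoc)
  qed
  from faithful_q[OF this] show ?thesis by simp
qed

end

context peirce_preserver
begin

interpretation swap: peirce_preserver q p \<phi> k
  by (rule swapped)

text \<open>
  Additivity propagates backwards along the probes: a preimage \<open>H\<close> of \<open>\<phi> A + \<phi> B\<close> has the same
  four corners as \<open>A + B\<close>.
\<close>

lemma additive_atI:
  assumes "additive_at (skew (q * A * p)) (skew (q * B * p))"
    and "additive_at (skew (p * A * q)) (skew (p * B * q))"
    and "\<And>Y. additive_at (skew (q * Y * p * A * p)) (skew (q * Y * p * B * p))"
    and "\<And>Y. additive_at (skew (p * Y * q * A * q)) (skew (p * Y * q * B * q))"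
  shows "additive_at A B"
proof -
  obtain H where H: "\<phi> H = \<phi> A + \<phi> B"
    using surjD[OF bij_is_surj[OF bij], of "\<phi> A + \<phi> B"] by metis
  have "H = A + B"
    by (rule peirce_eqI; rule corner_pp_eq[OF H assms(3)] swap.corner_qp_eq[OF H assms(2)]
        corner_qp_eq[OF H assms(1)] swap.corner_pp_eq[OF H assms(4)])
  then show ?thesis using H by (simp add: additive_at_def)
qed

text \<open>Each probe sees a single corner, so it annihilates \<open>A\<close> or \<open>B\<close>.\<close>

lemma additive_at_disjoint:
  assumes "q * A * p = 0 \<or> q * B * p = 0" "p * A * q = 0 \<or> p * B * q = 0"
    "p * A * p = 0 \<or> p * B * p = 0" "q * A * q = 0 \<or> q * B * q = 0"
  shows "additive_at A B"
proof (rule additive_atI)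
  show "additive_at (skew (q * Y * p * A * p)) (skew (q * Y * p * B * p))" for Y
    using assms(3) by (elim disjE) (simp_all add: mult.assoc)
  show "additive_at (skew (p * Y * q * A * q)) (skew (p * Y * q * B * q))" for Y
    using assms(4) by (elim disjE) (simp_all add: mult.assoc)
qed (use assms in auto)

text \<open>
  For \<open>a\<close> and \<open>b\<close> in the same corner \<open>p\<AA>q\<close>, the criterion for disjoint corners says nothing. It
  does apply to the pairs \<open>p, a\<close> and \<open>q, b\<close>, and their sums multiply to
  \<open>[p + a, q + b] = a + b - a\<^sup>* - ba\<^sup>*\<close>. The unwanted term \<open>ba\<^sup>*\<close> lies in \<open>p\<AA>p\<close> and is
  filtered out by the brackets with \<open>q\<close>.
\<close>

lemma additive_at_skew_corners: "additive_at (skew (p * A * q)) (skew (p * B * q))"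
proof -
  define a b where "a = p * A * q" and "b = p * B * q"
  define T where "T = p_tail k q"
  have T: "T X H = skew (p * star_lie X H * q)" if "q * star_lie X H * q = 0" for X H
    unfolding T_def using swap.p_tail_corner[OF k that] .
  have vals: "T p q = 0" "T p b = skew b" "T a q = skew a" "T a b = 0"
    by (subst T; simp add: star_lie_def a_def b_def peirce_simps algebra_simps)+
  have "T (p + a) (q + b) = skew a + skew b"
    unfolding T_def by (simp only: p_tail_add_left p_tail_add_right)
      (simp add: vals add.commute flip: T_def)
  then have "\<phi> (skew a + skew b) = p_tail k (\<phi> q) (\<phi> (p + a)) (\<phi> (q + b))"
    by (simp add: T_def flip: preserves_q)
  moreover have "additive_at p a" "additive_at q b"
    by (rule additive_at_disjoint; simp add: a_def b_def peirce_simps)+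
  ultimately have "\<phi> (skew a + skew b) = p_tail k (\<phi> q) (\<phi> p + \<phi> a) (\<phi> q + \<phi> b)"
    by (simp add: additive_at_def)
  also have "\<dots> = \<phi> (T p q) + \<phi> (T p b) + (\<phi> (T a q) + \<phi> (T a b))"
    by (simp add: T_def preserves_q p_tail_add_left p_tail_add_right)
  finally show ?thesis
    by (simp add: additive_at_def vals add.commute flip: a_def b_def)
qed

text \<open>Every probe value is \<open>V - V\<^sup>*\<close> for some \<open>V\<close> in an off-diagonal corner.\<close>

lemma additive: "\<phi> (A + B) = \<phi> A + \<phi> B"
proof -
  note pq_corners = additive_at_skew_corners
  note qp_corners = peirce_preserver.additive_at_skew_corners[OF swapped]
  have "additive_at A B"
  proof (rule additive_atI)
    show "additive_at (skew (q * A * p)) (skew (q * B * p))" by (rule qp_corners)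
    show "additive_at (skew (p * A * q)) (skew (p * B * q))" by (rule pq_corners)
    show "additive_at (skew (q * Y * p * A * p)) (skew (q * Y * p * B * p))" for Y
      using qp_corners[of "Y * p * A" "Y * p * B"] by (simp only: mult.assoc)
    show "additive_at (skew (p * Y * q * A * q)) (skew (p * Y * q * B * q))" for Y
      using pq_corners[of "Y * q * A" "Y * q * B"] by (simp only: mult.assoc)
  qed
  then show ?thesis by (simp add: additive_at_def)
qed

text \<open>
  With \<open>\<phi> 1 = 1\<close>, evaluating both sides by \<open>p_tail_one\<close> gives
  \<open>\<phi> (A - A\<^sup>*) = \<phi> A - (\<phi> A)\<^sup>*\<close> up to the factor \<open>2\<^sup>k\<close>.
\<close>

lemma preserves_star:
  assumes one: "\<phi> 1 = 1"
    and preserves_one: "\<phi> (p_tail k 1 A 1) = p_tail k (\<phi> 1) (\<phi> A) (\<phi> 1)"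
  shows "\<phi> (star A) = star (\<phi> A)"
proof -
  have pow: "\<phi> (2 ^ m *\<^sub>R x) = 2 ^ m *\<^sub>R \<phi> x" for m x
  proof (induction m)
    case (Suc m)
    have "\<phi> (2 ^ Suc m *\<^sub>R x) = \<phi> (2 ^ m *\<^sub>R x + 2 ^ m *\<^sub>R x)"
      by (simp flip: scaleR_add_left)
    also have "\<dots> = 2 ^ m *\<^sub>R \<phi> x + 2 ^ m *\<^sub>R \<phi> x" by (simp only: additive Suc)
    finally show ?case by (simp flip: scaleR_add_left)
  qed simp
  have "2 ^ k *\<^sub>R \<phi> (A - star A) = 2 ^ k *\<^sub>R (\<phi> A - star (\<phi> A))"
    using preserves_one by (simp add: one p_tail_one pow)
  then have "\<phi> (A - star A) = \<phi> A - star (\<phi> A)" by simp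
  moreover have "\<phi> A = \<phi> (A - star A) + \<phi> (star A)"
    by (simp flip: additive)
  ultimately show ?thesis by simp
qed

end

section \<open>Bijective unital preservers are star-additive\<close>

theorem theorem2p1:
  fixes n :: nat
    and P1 P2 :: "'a::unital_cstar_algebra"
    and \<phi> :: "'a \<Rightarrow> 'b::unital_cstar_algebra"
  assumes "n \<ge> 2"
    and "nontrivial_symmetric_projection P1"
    and "P2 = 1 - P1"
    and "nontrivial_symmetric_projection P2"
    and "\<And>P X. P \<in> {P1, P2} \<Longrightarrow> (\<lambda>Y. P * Y * X) ` UNIV = {0} \<Longrightarrow> X = 0"
    and "bij \<phi>"
    and "\<phi> 1 = 1"
    and "\<And>A B \<Xi>. \<Xi> \<in> {P1, P2, 1} \<Longrightarrow>
           \<phi> (p_star (A # B # replicate (n - 2) \<Xi>)) =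
           p_star (\<phi> A # \<phi> B # replicate (n - 2) (\<phi> \<Xi>))"
  shows "star_additive \<phi>"
proof -
  have tail: "\<phi> (p_tail (n - 2) \<Xi> A B) = p_tail (n - 2) (\<phi> \<Xi>) (\<phi> A) (\<phi> B)"
    if "\<Xi> \<in> {P1, P2, 1}" for \<Xi> A B
    using assms(8)[OF that] by (simp add: p_star_replicate)
  obtain k where k: "k \<ge> 1"
    and pres: "\<And>\<Xi> A B. \<Xi> \<in> {P1, P2, 1} \<Longrightarrow>
      \<phi> (p_tail k \<Xi> A B) = p_tail k (\<phi> \<Xi>) (\<phi> A) (\<phi> B)"
  proof (cases "n = 2")
    case True
    then have lie: "\<phi> (star_lie A B) = star_lie (\<phi> A) (\<phi> B)" for A B
      using tail[of 1 A B] by (simp add: p_tail_def)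
    \<comment> \<open>Bracketing both sides once more with any \<open>\<Xi>\<close> and its image moves to the case of three factors.\<close>
    show ?thesis
      by (rule that[of 1]) (simp_all add: p_tail_def lie)
  next
    case False
    with assms(1) have "n - 2 \<ge> 1" by simp
    with tail show ?thesis by (rule that[rotated])
  qed
  have faithful: "X = 0" if "P \<in> {P1, P2}" "\<And>Y. P * Y * X = 0" for P X
    using assms(5)[OF that(1), of X] that(2) by auto
  interpret peirce_preserver P1 P2 \<phi> k
  proof unfold_locales
    show "x = 0" if "\<And>Y. P1 * Y * x = 0" for x using faithful[of P1] that by simp
    show "x = 0" if "\<And>Y. P2 * Y * x = 0" for x using faithful[of P2] that by simp
  qed (use assms(2,4) k in \<open>simp_all add: assms(3,6) pres
      nontrivial_symmetric_projection_def symmetric_projection_def\<close>)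
  show ?thesis
    using additive preserves_star[OF assms(7) pres] by (simp add: star_additive_def)
qed

end
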